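(* Let $G=(V,E)$ be a Cartesian product of directed graphs $G=G_1\otimes\cdots\otimes G_k$, where $G_l=(V_l,E_l)$ has positive edge lengths and maximum out-degree $D_l$ with $1\le D_l<\infty$, and let $D$ be the maximum out-degree of $G$ (so $D_l\le D$). Let $a^1,\dots,a^T\in V$ be any actions and $u^1,\dots,u^T:V\to\mathbb{R}$ any utility functions. For $l\in\{1,\dots,k\}$ define $u^t_l:V_l\to\mathbb{R}$ by $u^t_l(a_l)=u^t(\langle a^t_1,\dots,a^t_{l-1},a_l,a^t_{l+1},\dots,a^t_k\rangle)$, and $$R^{T,l}_{\mathrm{localexternal}}=\max_{b\in V_l}\Big(\sum_{(i,j)\in E^b_l}\sum_{t=1}^T\mathbf 1(a^t_l=i)\,(u^t_l(j)-u^t_l(i))/D_l\Big)^+,$$ where $E^b_l=\{(i,j)\in E_l:\ d_l(i,b)=c_l(i,j)+d_l(j,b)\}$ is the set of edges of $G_l$ that move closer to $b$. Then $$R^T_{\mathrm{localexternal}}\le\sum_{l=1}^k R^{T,l}_{\mathrm{localexternal}} .$$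
   Context: The vertices of the Cartesian product are tuples $\langle v_1,\dots,v_k\rangle$ with $v_l\in V_l$; there is an edge from $v$ to $w$ iff there is an $l$ with $(v_l,w_l)\in E_l$ and $v_m=w_m$ for all $m\ne l$, and the length of this edge is $c(v,w)=c_l(v_l,w_l)$, where $c_l$ is the length function of $G_l$. Vertex sets may be infinite; then $\max$ means supremum. $d(a,b)$ (resp. $d_l$) denotes the total length of a shortest directed path from $a$ to $b$ in $G$ (resp. $G_l$); such shortest paths are assumed to exist for all pairs of vertices. Write $x^+=\max(x,0)$ and $R^T_{a,b}=\sum_{t=1}^T\mathbf 1(a^t=a)(u^t(b)-u^t(a))$. With $E^b=\{(i,j)\in E: d(i,b)=c(i,j)+d(j,b)\}$, the local external regret on $G$ is $R^T_{\mathrm{localexternal}}=\max_{b\in V}\big(\sum_{(i,j)\in E^b}R^T_{i,j}/D\big)^+$. (Only finitely many summands are nonzero.) *)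

theory Defs
  imports
    "Graph_Theory.Pair_Digraph"
    "Graph_Theory.Shortest_Path"
    "HOL-Library.Extended_Nat"
    "HOL-Library.FuncSet"
    "HOL-Analysis.Infinite_Sum"
begin

text \<open>
  A directed graph with edge lengths is a \<^typ>\<open>'v pair_pre_digraph\<close> (vertex set, set of ordered
  pairs) together with a length function \<open>c\<close> on pairs. Vertex sets may be infinite.
\<close>

abbreviation dgraph_awalk ::
    "'v pair_pre_digraph \<Rightarrow> 'v \<Rightarrow> ('v \<times> 'v) list \<Rightarrow> 'v \<Rightarrow> bool" where
  "dgraph_awalk G \<equiv> pre_digraph.awalk (with_proj G)"

abbreviation dgraph_dist ::
    "'v pair_pre_digraph \<Rightarrow> ('v \<times> 'v \<Rightarrow> real) \<Rightarrow> 'v \<Rightarrow> 'v \<Rightarrow> ereal" where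
  "dgraph_dist G \<equiv> wf_digraph.\<mu> (with_proj G)"

text \<open>
  Both \<open>p\<close> and \<open>q\<close> range over walks; as edge lengths will be positive, a shortest walk does not repeat
  vertices, so this is the same as existence of a shortest path.
\<close>

definition shortest_paths_exist :: "'v pair_pre_digraph \<Rightarrow> ('v \<times> 'v \<Rightarrow> real) \<Rightarrow> bool" where
  "shortest_paths_exist G c \<longleftrightarrow> (\<forall>a\<in>pverts G. \<forall>b\<in>pverts G. \<exists>p. dgraph_awalk G a p b \<and>
     (\<forall>q. dgraph_awalk G a q b \<longrightarrow> wf_digraph.awalk_cost c p \<le> wf_digraph.awalk_cost c q))"

text \<open>
  The case distinction is needed because \<^const>\<open>out_degree\<close> is a \<^const>\<open>card\<close>, hence \<open>0\<close> for
  vertices with infinitely many out-arcs. The supremum is attained whenever it is finite and the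
  graph has a vertex.
\<close>

definition max_out_degree :: "'v pair_pre_digraph \<Rightarrow> enat" where
  "max_out_degree G = (SUP v\<in>pverts G.
     if finite (out_arcs (with_proj G) v) then enat (out_degree (with_proj G) v) else \<infinity>)"

definition cart_step ::
    "nat \<Rightarrow> (nat \<Rightarrow> 'v pair_pre_digraph) \<Rightarrow> nat \<Rightarrow> (nat \<Rightarrow> 'v) \<Rightarrow> (nat \<Rightarrow> 'v) \<Rightarrow> bool" where
  "cart_step k G l v w \<longleftrightarrow>
     l \<in> {1..k} \<and> (v l, w l) \<in> parcs (G l) \<and> (\<forall>m\<in>{1..k} - {l}. v m = w m)"

definition cart_prod ::
    "nat \<Rightarrow> (nat \<Rightarrow> 'v pair_pre_digraph) \<Rightarrow> (nat \<Rightarrow> 'v) pair_pre_digraph" where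
  "cart_prod k G =
     (let V = (\<Pi>\<^sub>E l\<in>{1..k}. pverts (G l))
      in \<lparr> pverts = V, parcs = {(v, w). v \<in> V \<and> w \<in> V \<and> (\<exists>l. cart_step k G l v w)} \<rparr>)"

text \<open>
  The coordinate \<open>l\<close> of an edge \<open>(v, w)\<close> is unique if \<open>v \<noteq> w\<close>. Only for a loop, whose length is
  not uniquely determined by the factors, does the choice operator actually choose.
\<close>

definition cart_len ::
    "nat \<Rightarrow> (nat \<Rightarrow> 'v pair_pre_digraph) \<Rightarrow> (nat \<Rightarrow> 'v \<times> 'v \<Rightarrow> real)
      \<Rightarrow> (nat \<Rightarrow> 'v) \<times> (nat \<Rightarrow> 'v) \<Rightarrow> real" where
  "cart_len k G c = (\<lambda>(v, w). let l = (SOME l. cart_step k G l v w) in c l (v l, w l))"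

definition closer_arcs :: "'v pair_pre_digraph \<Rightarrow> ('v \<times> 'v \<Rightarrow> real) \<Rightarrow> 'v \<Rightarrow> ('v \<times> 'v) set" where
  "closer_arcs G c b =
     {(i, j) \<in> parcs G. dgraph_dist G c i b = ereal (c (i, j)) + dgraph_dist G c j b}"

definition switch_regret ::
    "nat \<Rightarrow> (nat \<Rightarrow> 'v) \<Rightarrow> (nat \<Rightarrow> 'v \<Rightarrow> real) \<Rightarrow> 'v \<Rightarrow> 'v \<Rightarrow> real" where
  "switch_regret T a u i j = (\<Sum>t=1..T. of_bool (a t = i) * (u t j - u t i))"

text \<open>
  The set of edges may be infinite, so a plain \<^const>\<open>sum\<close> would collapse to \<open>0\<close>; when out-degrees
  are finite, only finitely many summands of the \<^const>\<open>infsum\<close> are nonzero.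
\<close>

definition local_external_regret ::
    "'v pair_pre_digraph \<Rightarrow> ('v \<times> 'v \<Rightarrow> real) \<Rightarrow> nat \<Rightarrow> (nat \<Rightarrow> 'v) \<Rightarrow> (nat \<Rightarrow> 'v \<Rightarrow> real) \<Rightarrow> real" where
  "local_external_regret G c T a u =
     (SUP b\<in>pverts G. max 0 (\<Sum>\<^sub>\<infinity>(i, j)\<in>closer_arcs G c b.
        switch_regret T a u i j / real (the_enat (max_out_degree G))))"

text \<open>
  The next two lemmas confirm that the sums are finite and that the real-valued supremum is taken
  over a bounded set.
\<close>

lemma finite_switch_regret_support:
  assumes "max_out_degree G < \<infinity>" "\<And>t. t \<in> {1..T} \<Longrightarrow> a t \<in> pverts G"
  shows "finite {(i, j) \<in> parcs G. switch_regret T a u i j \<noteq> 0}"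
proof -
  have fin: "finite (out_arcs (with_proj G) v)" if "v \<in> pverts G" for v
  proof (rule ccontr)
    assume "infinite (out_arcs (with_proj G) v)"
    then have "\<infinity> \<le> max_out_degree G"
      unfolding max_out_degree_def using that by (intro SUP_upper2[where i=v]) auto
    with assms(1) show False by simp
  qed
  have "{(i, j) \<in> parcs G. switch_regret T a u i j \<noteq> 0} \<subseteq> (\<Union>t\<in>{1..T}. out_arcs (with_proj G) (a t))"
  proof clarify
    fix i j assume "(i, j) \<in> parcs G" "switch_regret T a u i j \<noteq> 0"
    then obtain t where "t \<in> {1..T}" "a t = i"
      unfolding switch_regret_def by (auto elim!: sum.not_neutral_contains_not_neutral)
    then show "(i, j) \<in> (\<Union>t\<in>{1..T}. out_arcs (with_proj G) (a t))"
      using \<open>(i, j) \<in> parcs G\<close> by (auto simp: out_arcs_def)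
  qed
  then show ?thesis
    by (rule finite_subset) (use fin assms(2) in auto)
qed

lemma bdd_above_local_external_regret:
  assumes "max_out_degree G < \<infinity>" "\<And>t. t \<in> {1..T} \<Longrightarrow> a t \<in> pverts G"
  shows "bdd_above ((\<lambda>b. max 0 (\<Sum>\<^sub>\<infinity>(i, j)\<in>closer_arcs G c b.
    switch_regret T a u i j / real (the_enat (max_out_degree G)))) ` pverts G)"
proof -
  define D where "D = real (the_enat (max_out_degree G))"
  define f where "f = (\<lambda>(i, j). switch_regret T a u i j / D)"
  define S where "S = {(i, j) \<in> parcs G. switch_regret T a u i j \<noteq> 0}"
  have S: "finite S"
    unfolding S_def by (rule finite_switch_regret_support[OF assms])
  have "infsum f (closer_arcs G c b) \<le> (\<Sum>e\<in>S. \<bar>f e\<bar>)" for b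
  proof -
    have "infsum f (closer_arcs G c b) = infsum f (closer_arcs G c b \<inter> S)"
      by (rule infsum_cong_neutral) (auto simp: f_def S_def closer_arcs_def)
    also have "\<dots> = sum f (closer_arcs G c b \<inter> S)"
      using S by simp
    also have "\<dots> \<le> (\<Sum>e\<in>closer_arcs G c b \<inter> S. \<bar>f e\<bar>)"
      by (rule sum_mono) simp
    also have "\<dots> \<le> (\<Sum>e\<in>S. \<bar>f e\<bar>)"
      by (rule sum_mono2) (use S in auto)
    finally show ?thesis .
  qed
  then show ?thesis
    unfolding f_def[symmetric] D_def[symmetric]
    by (intro bdd_aboveI2[where M="\<Sum>e\<in>S. \<bar>f e\<bar>"]) (simp add: sum_nonneg)
qed

end

theory Submission
  imports Defs
begin

text \<open>
  In a Cartesian product the distance to \<open>b\<close> is the sum of the coordinatewise distances, so an edge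
  moves closer to \<open>b\<close> iff its projection to the coordinate \<open>l\<close> in which it moves is an edge of
  \<open>G l\<close> moving closer to \<open>b l\<close>. Hence the regret sum for \<open>b\<close> splits into the regret sums of the
  factors for the coordinates \<open>b l\<close>. The normalising constants only help, as a factor never has
  larger maximum out-degree than the product.
\<close>

subsection \<open>Distances\<close>

text \<open>Prepending \<open>e\<close> to a walk from its head gives a walk from its tail. The
  finite length \<open>f e\<close> is first moved to the left, so that the claim becomes a lower
  bound on the infimum over walks from the head.\<close>

lemma (in wf_digraph) mu_tail_le:
  assumes "e \<in> arcs G"
  shows "\<mu> f (tail G e) v \<le> ereal (f e) + \<mu> f (head G e) v"
proof -
  have "\<mu> f (tail G e) v - ereal (f e) \<le> \<mu> f (head G e) v"
    unfolding \<mu>_def[of f "head G e" v]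
  proof (rule INF_greatest)
    fix p assume "p \<in> {p. awalk (head G e) p v}"
    then have "awalk (tail G e) (e # p) v"
      using assms by (simp add: awalk_Cons_iff)
    from min_cost_le_walk_cost[OF this, of f]
    show "\<mu> f (tail G e) v - ereal (f e) \<le> ereal (awalk_cost f p)"
      by (simp add: ereal_minus_le add.commute)
  qed
  then show ?thesis
    by (simp add: ereal_minus_le add.commute)
qed

text \<open>A cheapest walk turns the infimum \<open>\<mu>\<close> into a minimum. Hence distances
  between vertices are real numbers, not merely extended reals.\<close>

lemma (in pair_wf_digraph) dgraph_dist_attained:
  assumes "shortest_paths_exist G c" "x \<in> pverts G" "y \<in> pverts G"
  obtains p where "awalk x p y" "dgraph_dist G c x y = ereal (awalk_cost c p)"
proof -
  obtain p where p: "awalk x p y" "\<And>q. awalk x q y \<Longrightarrow> awalk_cost c p \<le> awalk_cost c q"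
    using assms unfolding shortest_paths_exist_def by blast
  have "\<mu> c x y = ereal (awalk_cost c p)"
    unfolding \<mu>_def
  proof (rule antisym)
    show "(INF p\<in>{p. awalk x p y}. ereal (awalk_cost c p)) \<le> ereal (awalk_cost c p)"
      by (rule INF_lower) (use p in simp)
    show "ereal (awalk_cost c p) \<le> (INF p\<in>{p. awalk x p y}. ereal (awalk_cost c p))"
      by (rule INF_greatest) (use p in simp)
  qed
  with p(1) that show ?thesis by blast
qed

subsection \<open>Out-degrees\<close>

lemma finite_out_arcs_max_out_degree:
  assumes "max_out_degree G < \<infinity>" "v \<in> pverts G"
  shows "finite (out_arcs (with_proj G) v)"
    "card (out_arcs (with_proj G) v) \<le> the_enat (max_out_degree G)"
proof -
  have le: "(if finite (out_arcs (with_proj G) v) then enat (out_degree (with_proj G) v) else \<infinity>)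
      \<le> max_out_degree G"
    unfolding max_out_degree_def by (rule SUP_upper[OF assms(2)])
  then show fin: "finite (out_arcs (with_proj G) v)"
    using assms(1) by (auto split: if_splits)
  obtain n where "max_out_degree G = enat n"
    using assms(1) by auto
  with le fin show "card (out_arcs (with_proj G) v) \<le> the_enat (max_out_degree G)"
    by (simp add: out_degree_def)
qed

lemma out_arcs_pair: "out_arcs (with_proj G) v = Pair v ` {w. (v, w) \<in> parcs G}"
  by (auto simp: out_arcs_def)

lemma finite_out_neighbours:
  assumes "max_out_degree G < \<infinity>" "v \<in> pverts G"
  shows "finite {w. (v, w) \<in> parcs G}"
  using finite_out_arcs_max_out_degree(1)[OF assms]
  by (simp add: out_arcs_pair finite_image_iff inj_on_def)

subsection \<open>Regret as a sum over time\<close>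

text \<open>Summing by rounds instead of by edges: round \<open>t\<close> only sees the arcs of
  \<open>A\<close> that leave \<open>a t\<close>. In this form the regret of the product can be
  split at one vertex at a time.\<close>

lemma infsum_switch_regret:
  assumes fin: "\<And>t. t \<in> {1..T} \<Longrightarrow> finite {j. (a t, j) \<in> A}"
  shows "(\<Sum>\<^sub>\<infinity>(i, j)\<in>A. switch_regret T a u i j / D) =
    (\<Sum>t=1..T. \<Sum>j | (a t, j) \<in> A. u t j - u t (a t)) / D"
proof -
  \<comment> \<open>The arcs of \<open>A\<close> that leave a played vertex: a finite set outside
    which every summand vanishes, so the infinite sum becomes a finite one.\<close>
  define S where "S = (SIGMA i:a ` {1..T}. {j. (i, j) \<in> A})"
  have S: "finite S"
    unfolding S_def using fin by auto
  have zero: "switch_regret T a u i j = 0" if "i \<notin> a ` {1..T}" for i j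
    unfolding switch_regret_def by (rule sum.neutral) (use that in auto)
  have "(\<Sum>\<^sub>\<infinity>(i, j)\<in>A. switch_regret T a u i j / D) =
      (\<Sum>\<^sub>\<infinity>(i, j)\<in>S. switch_regret T a u i j / D)"
    by (rule infsum_cong_neutral) (auto simp: S_def intro!: zero)
  also have "\<dots> = (\<Sum>(i, j)\<in>S. switch_regret T a u i j / D)"
    using S by simp
  also have "\<dots> = (\<Sum>(i, j)\<in>S. switch_regret T a u i j) / D"
    by (simp add: sum_divide_distrib case_prod_unfold)
  also have "(\<Sum>(i, j)\<in>S. switch_regret T a u i j) =
      (\<Sum>t=1..T. \<Sum>(i, j)\<in>S. of_bool (a t = i) * (u t j - u t i))"
    unfolding switch_regret_def case_prod_unfold by (rule sum.swap)
  also have "\<dots> = (\<Sum>t=1..T. \<Sum>j | (a t, j) \<in> A. u t j - u t (a t))"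
  proof (rule sum.cong[OF refl])
    fix t assume t: "t \<in> {1..T}"
    have "(\<Sum>(i, j)\<in>S. of_bool (a t = i) * (u t j - u t i)) =
        (\<Sum>i\<in>a ` {1..T}. \<Sum>j | (i, j) \<in> A. of_bool (a t = i) * (u t j - u t i))"
      unfolding S_def by (rule sum.Sigma[symmetric]) (use fin in auto)
    \<comment> \<open>The sources form a set, so a vertex played in several rounds occurs once and
      the indicator keeps exactly the term for \<open>a t\<close>.\<close>
    also have "\<dots> = (\<Sum>i\<in>a ` {1..T}. if a t = i then \<Sum>j | (i, j) \<in> A. u t j - u t i else 0)"
      by (rule sum.cong) auto
    also have "\<dots> = (\<Sum>j | (a t, j) \<in> A. u t j - u t (a t))"
      using t by simp
    finally show "(\<Sum>(i, j)\<in>S. of_bool (a t = i) * (u t j - u t i)) =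
        (\<Sum>j | (a t, j) \<in> A. u t j - u t (a t))" .
  qed
  finally show ?thesis .
qed

subsection \<open>Cartesian products\<close>

locale cart_factors =
  fixes k :: nat
    and G :: "nat \<Rightarrow> 'v pair_pre_digraph"
    and c :: "nat \<Rightarrow> 'v \<times> 'v \<Rightarrow> real"
  assumes wf: "\<And>l. l \<in> {1..k} \<Longrightarrow> pair_wf_digraph (G l)"
    and pos: "\<And>l e. l \<in> {1..k} \<Longrightarrow> e \<in> parcs (G l) \<Longrightarrow> 0 < c l e"
    and paths: "\<And>l. l \<in> {1..k} \<Longrightarrow> shortest_paths_exist (G l) (c l)"
    and deg: "\<And>l. l \<in> {1..k} \<Longrightarrow> 1 \<le> max_out_degree (G l) \<and> max_out_degree (G l) < \<infinity>"
begin

abbreviation "P \<equiv> cart_prod k G"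
abbreviation "len \<equiv> cart_len k G c"

text \<open>A real-valued copy of the factor distance, so that coordinates can be summed and
  cancelled freely. By \<open>dist_factor\<close> nothing is lost on vertices.\<close>

definition fdist :: "nat \<Rightarrow> 'v \<Rightarrow> 'v \<Rightarrow> real" where
  "fdist l x y = real_of_ereal (dgraph_dist (G l) (c l) x y)"

section \<open>Vertices, arcs and arc lengths of the product\<close>

lemma pverts_P: "pverts P = (\<Pi>\<^sub>E l\<in>{1..k}. pverts (G l))"
  by (simp add: cart_prod_def Let_def)

lemma parcs_P: "(v, w) \<in> parcs P \<longleftrightarrow> v \<in> pverts P \<and> w \<in> pverts P \<and> (\<exists>l. cart_step k G l v w)"
  by (simp add: cart_prod_def Let_def)

lemma pair_wf_P: "pair_wf_digraph P"
  by unfold_locales (auto simp: parcs_P)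

lemma pverts_P_coord: "v \<in> pverts P \<Longrightarrow> l \<in> {1..k} \<Longrightarrow> v l \<in> pverts (G l)"
  by (auto simp: pverts_P)

lemma pverts_P_upd:
  "v \<in> pverts P \<Longrightarrow> l \<in> {1..k} \<Longrightarrow> x \<in> pverts (G l) \<Longrightarrow> v(l := x) \<in> pverts P"
  by (auto simp: pverts_P PiE_iff extensional_def)

text \<open>Vertices of the product are extensional, so agreement in all other coordinates of
  \<open>{1..k}\<close> is equality of functions, and a step is a function update.\<close>

lemma cart_step_iff:
  assumes "v \<in> pverts P" "w \<in> pverts P"
  shows "cart_step k G l v w \<longleftrightarrow> l \<in> {1..k} \<and> (v l, w l) \<in> parcs (G l) \<and> w = v(l := w l)"
proof -
  have "(\<forall>m\<in>{1..k} - {l}. v m = w m) \<longleftrightarrow> w = v(l := w l)" if "l \<in> {1..k}"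
  proof
    assume eq: "\<forall>m\<in>{1..k} - {l}. v m = w m"
    show "w = v(l := w l)"
    proof
      fix m
      show "w m = (v(l := w l)) m"
        using assms eq by (cases "m \<in> {1..k}") (auto simp: pverts_P PiE_iff extensional_def)
    qed
  next
    assume "w = v(l := w l)"
    then show "\<forall>m\<in>{1..k} - {l}. v m = w m"
      by (metis DiffE fun_upd_other insertI1)
  qed
  then show ?thesis
    unfolding cart_step_def by blast
qed

lemma arc_upd:
  assumes "v \<in> pverts P" "l \<in> {1..k}" "(v l, x) \<in> parcs (G l)"
  shows "(v, v(l := x)) \<in> parcs P"
proof -
  interpret Gl: pair_wf_digraph "G l" by (rule wf[OF assms(2)])
  have "v(l := x) \<in> pverts P"
    using assms Gl.in_arcsD2 by (intro pverts_P_upd) auto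
  then show ?thesis
    using assms by (auto simp: parcs_P cart_step_iff intro!: exI[of _ l])
qed

text \<open>The coordinate obtained is the one chosen by \<open>cart_len\<close>. The length
  equation therefore also holds for loops, where several coordinates may qualify.\<close>

lemma arc_cases:
  assumes "(v, w) \<in> parcs P"
  obtains l where "l \<in> {1..k}" "(v l, w l) \<in> parcs (G l)" "w = v(l := w l)"
    "len (v, w) = c l (v l, w l)"
proof -
  define l where "l = (SOME l. cart_step k G l v w)"
  have "cart_step k G l v w"
    unfolding l_def using assms by (auto simp: parcs_P intro: someI_ex)
  moreover have "len (v, w) = c l (v l, w l)"
    by (simp add: cart_len_def l_def Let_def)
  ultimately show ?thesis
    using that assms by (auto simp: parcs_P cart_step_iff)
qed

text \<open>An update that really changes coordinate \<open>l\<close> determines \<open>l\<close>,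
  which leaves the choice in \<open>cart_len\<close> no freedom. A loop could take its length from
  another factor, hence \<open>x \<noteq> v l\<close>.\<close>

lemma len_upd:
  assumes "v \<in> pverts P" "l \<in> {1..k}" "(v l, x) \<in> parcs (G l)" "x \<noteq> v l"
  shows "len (v, v(l := x)) = c l (v l, x)"
proof -
  obtain m where m: "m \<in> {1..k}" "v(l := x) = v(m := (v(l := x)) m)"
      "len (v, v(l := x)) = c m (v m, (v(l := x)) m)"
    using arc_cases[OF arc_upd[OF assms(1-3)]] by blast
  from m(2) assms(4) have "m = l"
    by (metis fun_upd_apply)
  with m show ?thesis by simp
qed

section \<open>Distances in the product\<close>

lemma dist_factor:
  assumes "l \<in> {1..k}" "x \<in> pverts (G l)" "y \<in> pverts (G l)"
  shows "dgraph_dist (G l) (c l) x y = ereal (fdist l x y)"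
proof -
  interpret Gl: pair_wf_digraph "G l" by (rule wf[OF assms(1)])
  show ?thesis
    using Gl.dgraph_dist_attained[OF paths[OF assms(1)] assms(2,3)]
    by (metis fdist_def real_of_ereal.simps(1))
qed

lemma fdist_self_le:
  assumes "l \<in> {1..k}" "x \<in> pverts (G l)"
  shows "fdist l x x \<le> 0"
proof -
  interpret Gl: pair_wf_digraph "G l" by (rule wf[OF assms(1)])
  have "Gl.awalk x [] x"
    using assms by (simp add: Gl.awalk_Nil_iff)
  from Gl.min_cost_le_walk_cost[OF this, of "c l"] show ?thesis
    by (simp add: dist_factor[OF assms assms(2)])
qed

lemma fdist_arc_le:
  assumes "l \<in> {1..k}" "(x, y) \<in> parcs (G l)" "z \<in> pverts (G l)"
  shows "fdist l x z \<le> c l (x, y) + fdist l y z"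
proof -
  interpret Gl: pair_wf_digraph "G l" by (rule wf[OF assms(1)])
  show ?thesis
    using Gl.mu_tail_le[OF assms(2), of "c l" z] Gl.in_arcsD1[OF assms(2)] Gl.in_arcsD2[OF assms(2)] assms
    by (simp add: dist_factor)
qed

text \<open>The sum acts as a potential: an arc changes a single coordinate, where the triangle
  inequality of that factor lets the potential drop by at most the length of the arc.\<close>

lemma sum_fdist_le_walk_cost:
  assumes "dgraph_awalk P v p b"
  shows "(\<Sum>l=1..k. fdist l (v l) (b l)) \<le> wf_digraph.awalk_cost len p"
proof -
  interpret P: pair_wf_digraph P by (rule pair_wf_P)
  show ?thesis
    using assms
  proof (induction p arbitrary: v)
    case Nil
    then have "v = b" "b \<in> pverts P" by (auto simp: P.awalk_Nil_iff)
    then show ?case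
      using fdist_self_le pverts_P_coord by (auto intro!: sum_nonpos)
  next
    case (Cons e p)
    obtain w where e: "e = (v, w)" "(v, w) \<in> parcs P" and p: "dgraph_awalk P w p b"
      using Cons.prems by (cases e) (auto simp: P.awalk_Cons_iff)
    obtain l where l: "l \<in> {1..k}" "(v l, w l) \<in> parcs (G l)" "w = v(l := w l)"
        "len (v, w) = c l (v l, w l)"
      by (rule arc_cases[OF e(2)])
    have b: "b \<in> pverts P" using p by (rule P.awalk_last_in_verts)
    have "fdist m (v m) (b m) \<le> fdist m (w m) (b m) + (if m = l then c l (v l, w l) else 0)"
      if "m \<in> {1..k}" for m
    proof (cases "m = l")
      case True
      then show ?thesis
        using fdist_arc_le[OF l(1,2) pverts_P_coord[OF b l(1)]] by simp
    next
      case False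
      then have "w m = v m" using l(3) by (metis fun_upd_other)
      with False show ?thesis by simp
    qed
    then have "(\<Sum>m=1..k. fdist m (v m) (b m)) \<le>
        (\<Sum>m=1..k. fdist m (w m) (b m) + (if m = l then c l (v l, w l) else 0))"
      by (intro sum_mono) auto
    also have "\<dots> = (\<Sum>m=1..k. fdist m (w m) (b m)) + len (v, w)"
      using l by (simp add: sum.distrib)
    finally show ?case
      using Cons.IH[OF p] by (simp add: e)
  qed
qed

text \<open>The walk \<open>p\<close> is traced in coordinate \<open>l\<close> while the others stay
  fixed. Bounding distances arc by arc, instead of lifting \<open>p\<close> to a walk of the
  product, allows loops of \<open>p\<close> to be dropped.\<close>

lemma dist_upd_le_walk_cost:
  assumes l: "l \<in> {1..k}" and v: "v \<in> pverts P" and p: "dgraph_awalk (G l) x p y"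
  shows "dgraph_dist P len (v(l := x)) b
    \<le> ereal (wf_digraph.awalk_cost (c l) p) + dgraph_dist P len (v(l := y)) b"
proof -
  interpret P: pair_wf_digraph P by (rule pair_wf_P)
  interpret Gl: pair_wf_digraph "G l" by (rule wf[OF l])
  show ?thesis
    using p
  proof (induction p arbitrary: x)
    case Nil
    then show ?case by (auto simp: Gl.awalk_Nil_iff zero_ereal_def[symmetric])
  next
    case (Cons e p)
    obtain z where e: "e = (x, z)" "(x, z) \<in> parcs (G l)" and p: "dgraph_awalk (G l) z p y"
      using Cons.prems by (cases e) (auto simp: Gl.awalk_Cons_iff)
    have "dgraph_dist P len (v(l := x)) b \<le> ereal (c l (x, z)) + dgraph_dist P len (v(l := z)) b"
    proof (cases "x = z")
      case True
      \<comment> \<open>a loop must be skipped: in the product it may get its length from another factor\<close>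
      have "0 + dgraph_dist P len (v(l := x)) b \<le> ereal (c l (x, x)) + dgraph_dist P len (v(l := x)) b"
        using pos[OF l e(2)] True by (intro add_right_mono) auto
      with True show ?thesis by simp
    next
      case False
      have vx: "v(l := x) \<in> pverts P"
        using v l Gl.in_arcsD1[OF e(2)] by (rule pverts_P_upd)
      have "(v(l := x), v(l := z)) \<in> parcs P" "len (v(l := x), v(l := z)) = c l (x, z)"
        using arc_upd[OF vx l, of z] len_upd[OF vx l, of z] e(2) False by simp_all
      then show ?thesis
        using P.mu_tail_le[of "(v(l := x), v(l := z))" len b] by simp
    qed
    also have "\<dots> \<le> ereal (c l (x, z)) +
        (ereal (Gl.awalk_cost (c l) p) + dgraph_dist P len (v(l := y)) b)"
      by (intro add_left_mono Cons.IH p)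
    also have "\<dots> = ereal (Gl.awalk_cost (c l) (e # p)) + dgraph_dist P len (v(l := y)) b"
      by (simp add: e add.assoc[symmetric])
    finally show ?case .
  qed
qed

text \<open>From \<open>v\<close> one can reach \<open>b\<close> by correcting one coordinate after
  the other, each along a shortest walk of its factor.\<close>

lemma dist_P_le:
  assumes v: "v \<in> pverts P" and b: "b \<in> pverts P"
  shows "dgraph_dist P len v b \<le> ereal (\<Sum>l=1..k. fdist l (v l) (b l))"
proof -
  interpret P: pair_wf_digraph P by (rule pair_wf_P)
  \<comment> \<open>The intermediate vertex after the first \<open>n\<close> coordinates have been
    corrected: \<open>z 0\<close> is \<open>v\<close> and \<open>z k\<close> is
    \<open>b\<close>.\<close>
  define z where "z n = (\<lambda>l. if l \<in> {1..n} then b l else v l)" for n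
  have z: "z n \<in> pverts P" if "n \<le> k" for n
    using v b that by (auto simp: pverts_P z_def PiE_iff extensional_def)
  have step: "dgraph_dist P len v b
      \<le> ereal (\<Sum>l=1..n. fdist l (v l) (b l)) + dgraph_dist P len (z n) b" if "n \<le> k" for n
    using that
  proof (induction n)
    case 0
    then show ?case by (simp add: z_def zero_ereal_def[symmetric])
  next
    case (Suc n)
    define l where "l = Suc n"
    have l: "l \<in> {1..k}" using Suc.prems by (simp add: l_def)
    interpret Gl: pair_wf_digraph "G l" by (rule wf[OF l])
    obtain p where p: "dgraph_awalk (G l) (v l) p (b l)"
        "dgraph_dist (G l) (c l) (v l) (b l) = ereal (Gl.awalk_cost (c l) p)"
      using Gl.dgraph_dist_attained[OF paths[OF l] pverts_P_coord[OF v l] pverts_P_coord[OF b l]] .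
    have "dgraph_dist P len (z n) b \<le> ereal (fdist l (v l) (b l)) + dgraph_dist P len (z (Suc n)) b"
    proof -
      \<comment> \<open>Coordinate \<open>Suc n\<close> of \<open>z n\<close> is still that of
        \<open>v\<close>, so both ends of this stage are updates of \<open>z n\<close> at
        \<open>l\<close>.\<close>
      have "(z n)(l := v l) = z n" "(z n)(l := b l) = z (Suc n)"
        by (auto simp: z_def l_def fun_eq_iff)
      then show ?thesis
        using dist_upd_le_walk_cost[OF l z p(1), of n b] p(2) Suc.prems
          dist_factor[OF l pverts_P_coord[OF v l] pverts_P_coord[OF b l]] by simp
    qed
    then have "ereal (\<Sum>l=1..n. fdist l (v l) (b l)) + dgraph_dist P len (z n) b \<le>
        ereal (\<Sum>l=1..n. fdist l (v l) (b l)) +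
          (ereal (fdist l (v l) (b l)) + dgraph_dist P len (z (Suc n)) b)"
      by (rule add_left_mono)
    with Suc show ?case
      by (simp add: l_def add.assoc[symmetric])
  qed
  have "z k = b"
    using v b by (auto simp: z_def pverts_P fun_eq_iff PiE_iff extensional_def)
  moreover have "dgraph_dist P len b b \<le> 0"
    using P.min_cost_le_walk_cost[of b "[]" b len] b by (simp add: P.awalk_Nil_iff zero_ereal_def)
  ultimately show ?thesis
    using step[of k] by (metis add_left_mono add.right_neutral order.trans order_refl)
qed

text \<open>The lower bound over all walks and the coordinatewise upper bound meet; in particular,
  distances in the product are finite.\<close>

lemma dist_P:
  assumes "v \<in> pverts P" "b \<in> pverts P"
  shows "dgraph_dist P len v b = ereal (\<Sum>l=1..k. fdist l (v l) (b l))"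
proof (rule antisym[OF dist_P_le[OF assms]])
  interpret P: pair_wf_digraph P by (rule pair_wf_P)
  show "ereal (\<Sum>l=1..k. fdist l (v l) (b l)) \<le> dgraph_dist P len v b"
    unfolding P.\<mu>_def using sum_fdist_le_walk_cost by (intro INF_greatest) auto
qed

section \<open>Edges of the product that move closer to a target\<close>

lemma closer_factor_iff:
  assumes "l \<in> {1..k}" "y \<in> pverts (G l)"
  shows "(x, x') \<in> closer_arcs (G l) (c l) y \<longleftrightarrow>
    (x, x') \<in> parcs (G l) \<and> fdist l x y = c l (x, x') + fdist l x' y"
proof -
  interpret Gl: pair_wf_digraph "G l" by (rule wf[OF assms(1)])
  show ?thesis
    using Gl.in_arcsD1 Gl.in_arcsD2 assms by (auto simp: closer_arcs_def dist_factor)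
qed

text \<open>A loop has positive length, so it cannot satisfy the distance equation.\<close>

lemma closer_factor_neq:
  assumes "l \<in> {1..k}" "y \<in> pverts (G l)" "(x, x') \<in> closer_arcs (G l) (c l) y"
  shows "x \<noteq> x'"
  using pos[OF assms(1), of "(x, x')"] assms(3)
  by (cases "x = x'") (simp_all add: closer_factor_iff[OF assms(1,2)])

text \<open>By \<open>dist_P\<close> all coordinates other than \<open>l\<close> cancel from the
  distance equation. The length is a hypothesis so that either \<open>arc_cases\<close> or
  \<open>len_upd\<close> can supply it.\<close>

lemma closer_P_iff:
  assumes v: "v \<in> pverts P" and b: "b \<in> pverts P" and l: "l \<in> {1..k}"
    and arc: "(v l, x) \<in> parcs (G l)" and len: "len (v, v(l := x)) = c l (v l, x)"
  shows "(v, v(l := x)) \<in> closer_arcs P len b \<longleftrightarrow> (v l, x) \<in> closer_arcs (G l) (c l) (b l)"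
proof -
  interpret Gl: pair_wf_digraph "G l" by (rule wf[OF l])
  have vx: "v(l := x) \<in> pverts P"
    using v l Gl.in_arcsD2[OF arc] by (rule pverts_P_upd)
  have split: "(\<Sum>m=1..k. fdist m (w m) (b m)) =
      fdist l (w l) (b l) + (\<Sum>m\<in>{1..k} - {l}. fdist m (w m) (b m))" for w
    using l by (intro sum.remove) auto
  have "(\<Sum>m\<in>{1..k} - {l}. fdist m ((v(l := x)) m) (b m)) =
      (\<Sum>m\<in>{1..k} - {l}. fdist m (v m) (b m))"
    by (rule sum.cong) auto
  with split[of v] split[of "v(l := x)"]
  have "(v, v(l := x)) \<in> closer_arcs P len b \<longleftrightarrow>
      fdist l (v l) (b l) = c l (v l, x) + fdist l x (b l)"
    using arc_upd[OF v l arc] by (auto simp: closer_arcs_def dist_P v vx b len)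
  then show ?thesis
    using arc by (simp add: closer_factor_iff[OF l pverts_P_coord[OF b l]])
qed

text \<open>An arc of the product gets its coordinate and length from \<open>arc_cases\<close>.
  Conversely, an arc moving closer in a factor is no loop, so \<open>len_upd\<close> gives the
  length of its lift.\<close>

lemma closer_neighbours_P:
  assumes v: "v \<in> pverts P" and b: "b \<in> pverts P"
  shows "{w. (v, w) \<in> closer_arcs P len b} =
    (\<Union>l\<in>{1..k}. (\<lambda>x. v(l := x)) ` {x. (v l, x) \<in> closer_arcs (G l) (c l) (b l)})"
proof (intro equalityI subsetI)
  fix w assume w: "w \<in> {w. (v, w) \<in> closer_arcs P len b}"
  then have "(v, w) \<in> parcs P" by (simp add: closer_arcs_def)
  then obtain l where l: "l \<in> {1..k}" "(v l, w l) \<in> parcs (G l)" "w = v(l := w l)"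
      "len (v, w) = c l (v l, w l)"
    by (rule arc_cases)
  then have "(v l, w l) \<in> closer_arcs (G l) (c l) (b l)"
    using closer_P_iff[OF v b l(1,2)] w by simp
  with l(1,3) show "w \<in> (\<Union>l\<in>{1..k}. (\<lambda>x. v(l := x)) ` {x. (v l, x) \<in> closer_arcs (G l) (c l) (b l)})"
    by blast
next
  fix w assume "w \<in> (\<Union>l\<in>{1..k}. (\<lambda>x. v(l := x)) ` {x. (v l, x) \<in> closer_arcs (G l) (c l) (b l)})"
  then obtain l x where l: "l \<in> {1..k}" "(v l, x) \<in> closer_arcs (G l) (c l) (b l)" "w = v(l := x)"
    by auto
  have arc: "(v l, x) \<in> parcs (G l)" using l(2) by (simp add: closer_arcs_def)
  have "x \<noteq> v l" using closer_factor_neq[OF l(1) pverts_P_coord[OF b l(1)] l(2)] by simp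
  then show "w \<in> {w. (v, w) \<in> closer_arcs P len b}"
    using closer_P_iff[OF v b l(1) arc] len_upd[OF v l(1) arc] l by simp
qed

lemma finite_closer_factor:
  assumes "l \<in> {1..k}" "x \<in> pverts (G l)"
  shows "finite {x'. (x, x') \<in> closer_arcs (G l) (c l) y}"
  by (rule finite_subset[OF _ finite_out_neighbours[of "G l" x]])
    (use assms deg in \<open>auto simp: closer_arcs_def\<close>)

text \<open>The union over coordinates is disjoint because each update really changes its
  coordinate; the sum over neighbours therefore splits without double counting.\<close>

lemma sum_closer_neighbours_P:
  fixes f :: "(nat \<Rightarrow> 'v) \<Rightarrow> real"
  assumes v: "v \<in> pverts P" and b: "b \<in> pverts P"
  shows "(\<Sum>w | (v, w) \<in> closer_arcs P len b. f w) =
    (\<Sum>l=1..k. \<Sum>x | (v l, x) \<in> closer_arcs (G l) (c l) (b l). f (v(l := x)))"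
proof -
  let ?N = "\<lambda>l. {x. (v l, x) \<in> closer_arcs (G l) (c l) (b l)}"
  have neq: "x \<noteq> v l" if "l \<in> {1..k}" "x \<in> ?N l" for l x
    using closer_factor_neq[OF that(1) pverts_P_coord[OF b that(1)]] that(2) by auto
  have "(\<Sum>w | (v, w) \<in> closer_arcs P len b. f w) =
      (\<Sum>l=1..k. \<Sum>w\<in>(\<lambda>x. v(l := x)) ` ?N l. f w)"
    unfolding closer_neighbours_P[OF assms]
  proof (rule sum.UNION_disjoint)
    show "\<forall>l\<in>{1..k}. finite ((\<lambda>x. v(l := x)) ` ?N l)"
      using finite_closer_factor pverts_P_coord[OF v] by blast
    show "\<forall>l\<in>{1..k}. \<forall>m\<in>{1..k}. l \<noteq> m \<longrightarrow>
        (\<lambda>x. v(l := x)) ` ?N l \<inter> (\<lambda>x. v(m := x)) ` ?N m = {}"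
    proof (intro ballI impI equals0I)
      fix l m w assume lm: "l \<in> {1..k}" "m \<in> {1..k}" "l \<noteq> m"
        and "w \<in> (\<lambda>x. v(l := x)) ` ?N l \<inter> (\<lambda>x. v(m := x)) ` ?N m"
      then obtain x y where "x \<in> ?N l" "w = v(l := x)" "w = v(m := y)" by auto
      then show False using neq[OF lm(1)] lm(3) by (metis fun_upd_apply)
    qed
  qed simp
  also have "\<dots> = (\<Sum>l=1..k. \<Sum>x\<in>?N l. f (v(l := x)))"
  proof (rule sum.cong[OF refl])
    fix l
    have "inj_on (\<lambda>x. v(l := x)) (?N l)"
      by (rule inj_onI) (metis fun_upd_same)
    then show "(\<Sum>w\<in>(\<lambda>x. v(l := x)) ` ?N l. f w) = (\<Sum>x\<in>?N l. f (v(l := x)))"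
      by (simp add: sum.reindex)
  qed
  finally show ?thesis .
qed

section \<open>Maximum out-degree of the product\<close>

lemma pverts_P_nonempty: "pverts P \<noteq> {}"
proof -
  have "pverts (G l) \<noteq> {}" if "l \<in> {1..k}" for l
  proof
    assume "pverts (G l) = {}"
    \<comment> \<open>The supremum over no vertices is the least element of \<open>enat\<close>,
      which is \<open>0\<close>.\<close>
    then have "max_out_degree (G l) = 0" by (simp add: max_out_degree_def bot_enat_def)
    with deg[OF that] show False by simp
  qed
  then show ?thesis by (simp add: pverts_P PiE_eq_empty_iff)
qed

lemma out_arcs_P:
  assumes "v \<in> pverts P"
  shows "out_arcs (with_proj P) v =
    (\<Union>l\<in>{1..k}. (\<lambda>(x, y). (v, v(l := y))) ` out_arcs (with_proj (G l)) (v l))"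
proof (intro equalityI subsetI)
  fix e assume "e \<in> out_arcs (with_proj P) v"
  then obtain w where w: "e = (v, w)" "(v, w) \<in> parcs P" by (auto simp: out_arcs_pair)
  from w(2) obtain l where "l \<in> {1..k}" "(v l, w l) \<in> parcs (G l)" "w = v(l := w l)"
    by (rule arc_cases)
  with w(1) show "e \<in> (\<Union>l\<in>{1..k}. (\<lambda>(x, y). (v, v(l := y))) ` out_arcs (with_proj (G l)) (v l))"
    by (auto simp: out_arcs_pair image_image intro!: bexI[of _ l] image_eqI[of _ _ "w l"])
next
  fix e assume "e \<in> (\<Union>l\<in>{1..k}. (\<lambda>(x, y). (v, v(l := y))) ` out_arcs (with_proj (G l)) (v l))"
  then show "e \<in> out_arcs (with_proj P) v"
    using arc_upd[OF assms] by (auto simp: out_arcs_pair)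
qed

text \<open>The factor degrees add up to an upper bound. It is only a bound, as loops in different
  factors yield the same loop of the product.\<close>

lemma max_out_degree_P_finite: "max_out_degree P < \<infinity>"
proof -
  have "max_out_degree P \<le> enat (\<Sum>l=1..k. the_enat (max_out_degree (G l)))"
    unfolding max_out_degree_def[of P]
  proof (rule SUP_least)
    fix v assume v: "v \<in> pverts P"
    let ?A = "\<lambda>l. out_arcs (with_proj (G l)) (v l)"
    have A: "finite (?A l)" "card (?A l) \<le> the_enat (max_out_degree (G l))" if "l \<in> {1..k}" for l
      using finite_out_arcs_max_out_degree[of "G l" "v l"] deg[OF that] pverts_P_coord[OF v that]
      by auto
    have "card (out_arcs (with_proj P) v) \<le> (\<Sum>l=1..k. card ((\<lambda>(x, y). (v, v(l := y))) ` ?A l))"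
      unfolding out_arcs_P[OF v] by (rule card_UN_le) simp
    also have "\<dots> \<le> (\<Sum>l=1..k. the_enat (max_out_degree (G l)))"
      by (intro sum_mono order.trans[OF card_image_le] A)
    finally show "(if finite (out_arcs (with_proj P) v)
        then enat (out_degree (with_proj P) v) else \<infinity>)
        \<le> enat (\<Sum>l=1..k. the_enat (max_out_degree (G l)))"
      using A by (simp add: out_degree_def out_arcs_P[OF v])
  qed
  then show ?thesis
    using enat_ord_simps(4) order.strict_trans1 by blast
qed

text \<open>With \<open>x\<close> placed in coordinate \<open>l\<close> of any vertex of the
  product, the arcs leaving \<open>x\<close> inject into the arcs leaving that vertex.\<close>

lemma max_out_degree_factor_le:
  assumes l: "l \<in> {1..k}"
  shows "max_out_degree (G l) \<le> max_out_degree P"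
  unfolding max_out_degree_def[of "G l"]
proof (rule SUP_least)
  fix x assume x: "x \<in> pverts (G l)"
  obtain v0 where "v0 \<in> pverts P" using pverts_P_nonempty by auto
  define v where "v = v0(l := x)"
  have v: "v \<in> pverts P" "v l = x"
    using \<open>v0 \<in> pverts P\<close> l x by (simp_all add: v_def pverts_P_upd)
  let ?A = "out_arcs (with_proj (G l)) x"
  have fin: "finite ?A" "finite (out_arcs (with_proj P) v)"
    by (rule finite_out_arcs_max_out_degree; use deg[OF l] x v(1) max_out_degree_P_finite in blast)+
  have "inj_on (\<lambda>(x, y). (v, v(l := y))) ?A"
    unfolding out_arcs_pair by (intro inj_onI) (auto dest: fun_upd_eqD)
  then have "card ?A = card ((\<lambda>(x, y). (v, v(l := y))) ` ?A)"
    by (simp add: card_image)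
  also have "\<dots> \<le> card (out_arcs (with_proj P) v)"
    by (rule card_mono[OF fin(2)]) (use l v in \<open>auto simp: out_arcs_P\<close>)
  finally have "enat (out_degree (with_proj (G l)) x) \<le>
      (if finite (out_arcs (with_proj P) v) then enat (out_degree (with_proj P) v) else \<infinity>)"
    using fin by (simp add: out_degree_def)
  also have "\<dots> \<le> max_out_degree P"
    unfolding max_out_degree_def by (rule SUP_upper[OF v(1)])
  finally show "(if finite ?A then enat (out_degree (with_proj (G l)) x) else \<infinity>)
      \<le> max_out_degree P"
    using fin by simp
qed

text \<open>The comparison passes to natural numbers because both degrees are finite;
  \<open>the_enat\<close> is informative only there.\<close>

lemma the_max_out_degree_factor_le:
  assumes "l \<in> {1..k}"
  shows "the_enat (max_out_degree (G l)) \<le> the_enat (max_out_degree P)"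
    "1 \<le> the_enat (max_out_degree (G l))"
proof -
  obtain m n where "max_out_degree P = enat m" "max_out_degree (G l) = enat n"
    using max_out_degree_P_finite deg[OF assms] by (metis enat.exhaust less_irrefl)
  then show "the_enat (max_out_degree (G l)) \<le> the_enat (max_out_degree P)"
      "1 \<le> the_enat (max_out_degree (G l))"
    using max_out_degree_factor_le[OF assms] deg[OF assms] by (simp_all add: one_enat_def)
qed

section \<open>Regret of the product against the regrets of the factors\<close>

lemma local_external_regret_cart_prod_le:
  assumes a: "\<And>t. t \<in> {1..T} \<Longrightarrow> a t \<in> pverts P"
  shows "local_external_regret P len T a u
    \<le> (\<Sum>l=1..k. local_external_regret (G l) (c l) T (\<lambda>t. a t l) (\<lambda>t x. u t ((a t)(l := x))))"
  unfolding local_external_regret_def[of P]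
proof (rule cSUP_least[OF pverts_P_nonempty])
  fix b assume b: "b \<in> pverts P"
  define D where "D = real (the_enat (max_out_degree P))"
  define d where "d l = real (the_enat (max_out_degree (G l)))" for l
  \<comment> \<open>The regret sum of factor \<open>l\<close> for the target \<open>b l\<close>,
    before normalisation. The subtracted term is \<open>u t (a t)\<close> since updating
    \<open>a t\<close> at \<open>l\<close> with its own value changes nothing.\<close>
  define s where "s l = (\<Sum>t=1..T. \<Sum>x | (a t l, x) \<in> closer_arcs (G l) (c l) (b l).
      u t ((a t)(l := x)) - u t (a t))" for l
  let ?R = "\<lambda>l. local_external_regret (G l) (c l) T (\<lambda>t. a t l) (\<lambda>t x. u t ((a t)(l := x)))"
  have d: "1 \<le> d l" "d l \<le> D" if "l \<in> {1..k}" for l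
    using the_max_out_degree_factor_le[OF that] unfolding d_def D_def by simp_all
  \<comment> \<open>The vertex \<open>b l\<close> is one candidate in the supremum of factor
    \<open>l\<close>. Boundedness of that set is what makes the real supremum an upper
    bound.\<close>
  have fac: "max 0 (s l / d l) \<le> ?R l" if l: "l \<in> {1..k}" for l
  proof -
    have "(\<Sum>\<^sub>\<infinity>(i, j)\<in>closer_arcs (G l) (c l) (b l).
        switch_regret T (\<lambda>t. a t l) (\<lambda>t x. u t ((a t)(l := x))) i j / d l) = s l / d l"
      using finite_closer_factor[OF l] pverts_P_coord[OF a l]
      by (subst infsum_switch_regret) (auto simp: s_def)
    then have "max 0 (s l / d l) = max 0 (\<Sum>\<^sub>\<infinity>(i, j)\<in>closer_arcs (G l) (c l) (b l).
        switch_regret T (\<lambda>t. a t l) (\<lambda>t x. u t ((a t)(l := x))) i j / d l)"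
      by simp
    also have "\<dots> \<le> ?R l"
      unfolding local_external_regret_def d_def
      by (rule cSUP_upper[OF pverts_P_coord[OF b l] bdd_above_local_external_regret])
        (use deg[OF l] pverts_P_coord[OF a l] in auto)
    finally show ?thesis .
  qed
  have "finite {w. (a t, w) \<in> closer_arcs P len b}" if "t \<in> {1..T}" for t
    using finite_closer_factor pverts_P_coord[OF a[OF that]]
    by (auto simp: closer_neighbours_P[OF a[OF that] b])
  then have "(\<Sum>\<^sub>\<infinity>(i, j)\<in>closer_arcs P len b. switch_regret T a u i j / D) =
      (\<Sum>t=1..T. \<Sum>w | (a t, w) \<in> closer_arcs P len b. u t w - u t (a t)) / D"
    by (rule infsum_switch_regret)
  also have "(\<Sum>t=1..T. \<Sum>w | (a t, w) \<in> closer_arcs P len b. u t w - u t (a t)) =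
      (\<Sum>t=1..T. \<Sum>l=1..k. \<Sum>x | (a t l, x) \<in> closer_arcs (G l) (c l) (b l).
        u t ((a t)(l := x)) - u t (a t))"
    using a b by (intro sum.cong refl sum_closer_neighbours_P)
  also have "\<dots> = (\<Sum>l=1..k. s l)"
    unfolding s_def by (rule sum.swap)
  also have "(\<Sum>l=1..k. s l) / D = (\<Sum>l=1..k. s l / D)"
    by (rule sum_divide_distrib)
  also have "\<dots> \<le> (\<Sum>l=1..k. ?R l)"
  proof (rule sum_mono)
    fix l assume l: "l \<in> {1..k}"
    \<comment> \<open>For negative \<open>s l\<close>, replacing \<open>D\<close> by the smaller
      \<open>d l\<close> would go the wrong way, so the positive part is taken first.\<close>
    have "s l / D \<le> max 0 (s l) / D"
      using d[OF l] by (intro divide_right_mono) auto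
    also have "\<dots> \<le> max 0 (s l) / d l"
      using d[OF l] by (intro divide_left_mono) auto
    also have "\<dots> = max 0 (s l / d l)"
      using d(1)[OF l] by (simp add: max_def zero_le_divide_iff divide_le_0_iff)
    finally show "s l / D \<le> ?R l"
      using fac[OF l] by (rule order.trans)
  qed
  finally have "(\<Sum>\<^sub>\<infinity>(i, j)\<in>closer_arcs P len b. switch_regret T a u i j / D) \<le> (\<Sum>l=1..k. ?R l)" .
  \<comment> \<open>This covers the case in which the positive part on the left is
    \<open>0\<close>.\<close>
  moreover have "0 \<le> (\<Sum>l=1..k. ?R l)"
    using fac by (intro sum_nonneg) (meson max.bounded_iff)
  ultimately show "max 0 (\<Sum>\<^sub>\<infinity>(i, j)\<in>closer_arcs P len b.
      switch_regret T a u i j / real (the_enat (max_out_degree P))) \<le> (\<Sum>l=1..k. ?R l)"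
    by (simp add: D_def)
qed

end

theorem theorem3:
  fixes k T :: nat
    and G :: "nat \<Rightarrow> 'v pair_pre_digraph"
    and c :: "nat \<Rightarrow> 'v \<times> 'v \<Rightarrow> real"
    and a :: "nat \<Rightarrow> nat \<Rightarrow> 'v"
    and u :: "nat \<Rightarrow> (nat \<Rightarrow> 'v) \<Rightarrow> real"
  assumes "1 \<le> k"
    and "\<And>l. l \<in> {1..k} \<Longrightarrow> pair_wf_digraph (G l)"
    and "\<And>l e. l \<in> {1..k} \<Longrightarrow> e \<in> parcs (G l) \<Longrightarrow> 0 < c l e"
    and "\<And>l. l \<in> {1..k} \<Longrightarrow> shortest_paths_exist (G l) (c l)"
    and "\<And>l. l \<in> {1..k} \<Longrightarrow> 1 \<le> max_out_degree (G l) \<and> max_out_degree (G l) < \<infinity>"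
    and "\<And>t. t \<in> {1..T} \<Longrightarrow> a t \<in> pverts (cart_prod k G)"
  shows "local_external_regret (cart_prod k G) (cart_len k G c) T a u
    \<le> (\<Sum>l=1..k. local_external_regret (G l) (c l) T (\<lambda>t. a t l) (\<lambda>t x. u t ((a t)(l := x))))"
proof -
  interpret cart_factors k G c
    by (rule cart_factors.intro) (use assms(2-5) in blast)+
  show ?thesis
    using assms(6) by (rule local_external_regret_cart_prod_le)
qed

end
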